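(* Let $(X,d,p,\sigma)$ be a power distance space with $(p,\sigma)\in\mathbb{R}^*\times\mathbb{R}^+$. Let $x,y\in X$ and let $(x_n)$ be a sequence in $X$. If $(x_n)$ converges to $x$ in $(X,d)$ and $(x_n)$ converges to $y$ in $(X,d)$, then $x=y$.
   Context: A distance on a set $X$ is a function $d:X\times X\to\mathbb{R}$ such that for all $x,y\in X$: $d(x,y)\ge 0$; $d(x,y)=0\iff x=y$; $d(x,y)=d(y,x)$. The pair $(X,d)$ is then a distance space. A sequence $(x_n)$ converges to $x\in X$ in $(X,d)$ if for every real $\varepsilon>0$ there is $N$ such that $d(x_n,x)<\varepsilon$ for all $n>N$. $\mathbb{R}^*=\mathbb{R}\cup\{-\infty,\infty\}$ and $\mathbb{R}^+$ is the set of positive reals. The power triangle function is $\tau(p,\sigma;x,y,z;d)=2\sigma\left[\tfrac12 d^p(x,z)+\tfrac12 d^p(z,y)\right]^{1/p}$, where for $p=\infty,0,-\infty$ it is interpreted by its limit in $p$, namely $2\sigma\max\{d(x,z),d(z,y)\}$, $2\sigma\sqrt{d(x,z)}\sqrt{d(z,y)}$, $2\sigma\min\{d(x,z),d(z,y)\}$ respectively, and for $p<0$ with $d(x,z)=0$ or $d(z,y)=0$ it is read as its limiting value $0$. The tuple $(X,d,p,\sigma)$ is a power distance space if $(X,d)$ is a distance space and $d(x,y)\le\tau(p,\sigma;x,y,z;d)$ for all $x,y,z\in X$. *)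

theory Defs
  imports Complex_Main "HOL-Library.Extended_Real"
begin

definition distance_on :: "'a set \<Rightarrow> ('a \<Rightarrow> 'a \<Rightarrow> real) \<Rightarrow> bool" where
  "distance_on X d \<longleftrightarrow>
     (\<forall>x\<in>X. \<forall>y\<in>X. d x y \<ge> 0 \<and> (d x y = 0 \<longleftrightarrow> x = y) \<and> d x y = d y x)"

(* The library's limitin and (\<longlonglongrightarrow>) presuppose a topology; without a triangle
   inequality, convergence has to be read off the distance directly. *)
definition converges_in :: "'a set \<Rightarrow> ('a \<Rightarrow> 'a \<Rightarrow> real) \<Rightarrow> (nat \<Rightarrow> 'a) \<Rightarrow> 'a \<Rightarrow> bool" where
  "converges_in X d s x \<longleftrightarrow>
     range s \<subseteq> X \<and> x \<in> X \<and> (\<forall>\<epsilon>>0. \<exists>N. \<forall>n>N. d (s n) x < \<epsilon>)"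

(* The values at p = \<infinity>, 0, -\<infinity> are the limits in p of the generic formula. For p < 0
   and a vanishing distance the value is also the limit 0; this needs its own clause
   because 0 powr p = 0 in HOL, so the generic formula would be wrong there. *)
definition power_triangle ::
  "ereal \<Rightarrow> real \<Rightarrow> 'a \<Rightarrow> 'a \<Rightarrow> 'a \<Rightarrow> ('a \<Rightarrow> 'a \<Rightarrow> real) \<Rightarrow> real" where
  "power_triangle p \<sigma> x y z d =
     (if p = \<infinity> then 2 * \<sigma> * max (d x z) (d z y)
      else if p = -\<infinity> then 2 * \<sigma> * min (d x z) (d z y)
      else if p = 0 then 2 * \<sigma> * sqrt (d x z) * sqrt (d z y)
      else if p < 0 \<and> (d x z = 0 \<or> d z y = 0) then 0
      else 2 * \<sigma> * (1/2 * d x z powr real_of_ereal p + 1/2 * d z y powr real_of_ereal p)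
                     powr (1 / real_of_ereal p))"

definition power_distance_space ::
  "'a set \<Rightarrow> ('a \<Rightarrow> 'a \<Rightarrow> real) \<Rightarrow> ereal \<Rightarrow> real \<Rightarrow> bool" where
  "power_distance_space X d p \<sigma> \<longleftrightarrow>
     distance_on X d \<and> (\<forall>x\<in>X. \<forall>y\<in>X. \<forall>z\<in>X. d x y \<le> power_triangle p \<sigma> x y z d)"

end

theory Submission
  imports Defs
begin

text \<open>A power mean is at most the maximum of its arguments, whatever the exponent. So every
  power triangle inequality implies \<open>d x y \<le> 2 * \<sigma> * max (d x z) (d z y)\<close>, and along
  \<open>z = s n\<close> the right-hand side becomes arbitrarily small.\<close>

text \<open>Replacing both arguments by their maximum can only increase the mean. For
  \<open>r > 0\<close> both powers are monotone; for \<open>r < 0\<close> both are antitone and the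
  two reversals cancel. Positivity is demanded for \<open>r < 0\<close> because
  \<open>0 powr r = 0\<close> breaks antitonicity at 0.\<close>

lemma power_mean_le_max:
  fixes a b r :: real
  assumes "0 \<le> a" and "0 \<le> b" and "r \<noteq> 0" and "r < 0 \<Longrightarrow> 0 < a \<and> 0 < b"
  shows "(1/2 * a powr r + 1/2 * b powr r) powr (1 / r) \<le> max a b"
proof -
  define m where "m = max a b"
  have m: "a \<le> m" "b \<le> m" "0 \<le> m"
    using assms(1) by (auto simp: m_def)
  have "(1/2 * a powr r + 1/2 * b powr r) powr (1 / r) \<le> (m powr r) powr (1 / r)"
  proof (cases "r > 0")
    case True
    have "a powr r \<le> m powr r" "b powr r \<le> m powr r"
      using True m assms(1,2) by (auto intro: powr_mono2)
    then show ?thesis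
      using True by (intro powr_mono2) auto
  next
    case False
    with assms(3,4) have neg: "r < 0" "0 < a" "0 < b" by auto
    have "m powr r \<le> a powr r" "m powr r \<le> b powr r"
      using neg m by (auto intro: powr_mono2')
    \<comment> \<open>The outer power has the negative exponent \<open>1 / r\<close>, so it is
      antitone only on positive bases.\<close>
    moreover have "0 < m powr r"
      using neg m by auto
    ultimately show ?thesis
      using neg by (intro powr_mono2') auto
  qed
  also have "\<dots> = m"
    using assms(3) m(3) by (simp add: powr_powr)
  finally show ?thesis
    by (simp add: m_def)
qed

text \<open>This serves exponent 0, where the power mean becomes the geometric mean.\<close>

lemma sqrt_mult_sqrt_le_max:
  assumes "0 \<le> a" and "0 \<le> b"
  shows "sqrt a * sqrt b \<le> max a b"
proof -
  have "sqrt a * sqrt b \<le> sqrt (max a b) * sqrt (max a b)"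
    using assms by (intro mult_mono) auto
  also have "\<dots> = max a b"
    using assms by simp
  finally show ?thesis .
qed

lemma power_triangle_le_max:
  assumes "0 < \<sigma>" and "0 \<le> d x z" and "0 \<le> d z y"
  shows "power_triangle p \<sigma> x y z d \<le> 2 * \<sigma> * max (d x z) (d z y)"
proof (cases p)
  case (real r)
  \<comment> \<open>The split follows the clauses for finite \<open>p\<close>; what remains in the
    third case are the side conditions of \<open>power_mean_le_max\<close>.\<close>
  consider "r = 0" | "r < 0" "d x z = 0 \<or> d z y = 0"
    | "r \<noteq> 0" "r < 0 \<Longrightarrow> 0 < d x z \<and> 0 < d z y"
    using assms by fastforce
  then show ?thesis
  proof cases
    case 1
    then show ?thesis
      using real assms sqrt_mult_sqrt_le_max[of "d x z" "d z y"]
      by (simp add: power_triangle_def mult.assoc zero_ereal_def)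
  next
    case 2
    then show ?thesis
      using real assms by (auto simp: power_triangle_def zero_ereal_def)
  next
    case 3
    then have "power_triangle p \<sigma> x y z d =
        2 * \<sigma> * (1/2 * d x z powr r + 1/2 * d z y powr r) powr (1 / r)"
      using real by (auto simp: power_triangle_def zero_ereal_def)
    also have "\<dots> \<le> 2 * \<sigma> * max (d x z) (d z y)"
      using 3 assms power_mean_le_max[of "d x z" "d z y" r] by (intro mult_left_mono) auto
    finally show ?thesis .
  qed
qed (use assms in \<open>auto simp: power_triangle_def\<close>)

theorem theorem4p19:
  fixes X :: "'a set" and d :: "'a \<Rightarrow> 'a \<Rightarrow> real" and p :: ereal and \<sigma> :: real
    and x y :: 'a and s :: "nat \<Rightarrow> 'a"
  assumes "power_distance_space X d p \<sigma>"
    and "\<sigma> > 0"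
    and "x \<in> X" and "y \<in> X"
    and "\<And>n. s n \<in> X"
    and "converges_in X d s x"
    and "converges_in X d s y"
  shows "x = y"
proof (rule ccontr)
  assume "x \<noteq> y"
  have dist: "distance_on X d"
    and tri: "\<And>z. z \<in> X \<Longrightarrow> d x y \<le> power_triangle p \<sigma> x y z d"
    using assms(1,3,4) by (auto simp: power_distance_space_def)
  \<comment> \<open>Chosen so that the bound \<open>2 * \<sigma> * \<epsilon>\<close> is exactly
    \<open>d x y\<close>, which yields \<open>d x y < d x y\<close>.\<close>
  define \<epsilon> where "\<epsilon> = d x y / (2 * \<sigma>)"
  have "0 \<le> d x y" "d x y \<noteq> 0"
    using dist \<open>x \<noteq> y\<close> assms(3,4) by (auto simp: distance_on_def)
  then have "\<epsilon> > 0"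
    using assms(2) by (simp add: \<epsilon>_def)
  then obtain M N where "\<forall>n>M. d (s n) x < \<epsilon>" "\<forall>n>N. d (s n) y < \<epsilon>"
    using assms(6,7) unfolding converges_in_def by meson
  \<comment> \<open>The index \<open>Suc (max M N)\<close> lies beyond both thresholds.\<close>
  then obtain n where n: "d (s n) x < \<epsilon>" "d (s n) y < \<epsilon>"
    by (metis less_Suc_eq_le max.cobounded1 max.cobounded2)
  \<comment> \<open>Convergence controls \<open>d (s n) x\<close>, while the triangle bound with
    \<open>z = s n\<close> contains \<open>d x (s n)\<close>.\<close>
  have sym: "d x (s n) = d (s n) x" and nonneg: "0 \<le> d x (s n)" "0 \<le> d (s n) y"
    using dist assms(3-5) by (auto simp: distance_on_def)
  have "d x y \<le> 2 * \<sigma> * max (d x (s n)) (d (s n) y)"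
    using tri[OF assms(5)] power_triangle_le_max[of \<sigma> d x "s n" y, OF assms(2) nonneg] by (rule order_trans)
  also have "\<dots> < 2 * \<sigma> * \<epsilon>"
    using n sym assms(2) by simp
  also have "\<dots> = d x y"
    using assms(2) by (simp add: \<epsilon>_def)
  finally show False by simp
qed

end
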